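(* Let $\zeta\in\mathbb{H}$. The unit circle $\{v\in T_\zeta\mathbb{H}\cong\mathbb{C} : \|v\|_\delta=1\}$ of the tangent space at $\zeta$ with respect to the weak norm $\|\cdot\|_\delta$ is a parabola with focus at the origin and vertex at $i\,\mathrm{Im}(\zeta)$.
   Context: $\mathbb{H}=\{z\in\mathbb{C}\mid \mathrm{Im}(z)>0\}$, and each tangent space $T_\zeta\mathbb{H}$ is identified with $\mathbb{C}$ as a real vector space. The weak norm is $\|v\|_\delta=\dfrac{|v|+\mathrm{Im}(v)}{2\,\mathrm{Im}(\zeta)}$; it is the weak norm induced by the weak metric $\delta(\zeta_1,\zeta_2)=\log\sup_{x\in\mathbb{R}}\left|\frac{\zeta_2-x}{\zeta_1-x}\right|$, i.e. $\|v\|_\delta=\lim_{t\to0^+}\delta(\zeta,\zeta+tv)/t$. *)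

theory Defs
  imports "HOL-Analysis.Analysis"
begin

definition upper_half_plane :: "complex set" where
  "upper_half_plane = {z. Im z > 0}"

text \<open>Only meaningful for two points of the upper half plane, where the quotients are bounded
  in \<^term>\<open>x\<close>, so that the real supremum is the genuine one.\<close>

definition weak_metric :: "complex \<Rightarrow> complex \<Rightarrow> real" where
  "weak_metric \<zeta>1 \<zeta>2 =
     ln (SUP x\<in>(UNIV :: real set). norm ((\<zeta>2 - complex_of_real x) / (\<zeta>1 - complex_of_real x)))"

text \<open>The weak norm induced by the weak metric on the tangent space at \<open>\<zeta>\<close>, identified with
  the complex plane.  For \<open>\<zeta>\<close> in the upper half plane the limit exists and equals
  \<open>(norm v + Im v) / (2 * Im \<zeta>)\<close>.\<close>

definition weak_norm :: "complex \<Rightarrow> complex \<Rightarrow> real" where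
  "weak_norm \<zeta> v =
     Lim (at_right 0) (\<lambda>t::real. weak_metric \<zeta> (\<zeta> + complex_of_real t * v) / t)"

text \<open>Focus-directrix definition of a parabola in the plane: \<open>L\<close> is the directrix, and the
  vertex is the point of the curve on the axis, the perpendicular to \<open>L\<close> through the focus.\<close>

definition parabola_with_focus_vertex :: "complex set \<Rightarrow> complex \<Rightarrow> complex \<Rightarrow> bool" where
  "parabola_with_focus_vertex S F V \<longleftrightarrow>
     (\<exists>L. affine L \<and> aff_dim L = 1 \<and> F \<notin> L \<and>
          S = {p. dist p F = infdist p L} \<and>
          V \<in> S \<and> (\<forall>a\<in>L. \<forall>b\<in>L. (V - F) \<bullet> (a - b) = 0))"

end

theory Submission imports Defs begin

text \<open>As \<open>x\<close> runs over the reals, \<open>1 / (\<zeta> - x)\<close> runs over a circle through \<open>0\<close>, punctured at \<open>0\<close>.  Hence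
  the quotients \<open>(\<xi> - x) / (\<zeta> - x)\<close> run over a punctured circle as well, and the supremum of their
  norms is the norm of its centre plus its radius.  This closed form of the weak metric can be
  differentiated, which gives the weak norm, and \<open>norm v + Im v = 2 * Im \<zeta>\<close> is the focus-directrix
  equation with focus \<open>0\<close> and directrix \<open>Im v = 2 * Im \<zeta>\<close>.\<close>

text \<open>The factor \<open>cnj z / z\<close> has norm 1, so the right-hand side exhibits the
  circle: its centre is \<open>(\<xi> - cnj \<zeta>) / (\<zeta> - cnj \<zeta>)\<close> and its
  radius is \<open>norm (\<xi> - \<zeta>) / (2 * Im \<zeta>)\<close>.\<close>

lemma diff_quotient_on_circle:
  fixes \<zeta> \<xi> :: complex and x :: real
  assumes "Im \<zeta> > 0"
  defines "z \<equiv> \<zeta> - of_real x"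
  shows "(\<xi> - of_real x) / z = ((\<xi> - cnj \<zeta>) - (\<xi> - \<zeta>) * (cnj z / z)) / (\<zeta> - cnj \<zeta>)"
proof -
  have z: "z \<noteq> 0" using assms by (auto simp: complex_eq_iff)
  have d: "\<zeta> - cnj \<zeta> \<noteq> 0" using assms by (auto simp: complex_eq_iff)
  have "(\<xi> - cnj \<zeta>) - (\<xi> - \<zeta>) * (cnj z / z) = ((\<xi> - cnj \<zeta>) * z - (\<xi> - \<zeta>) * cnj z) / z"
    using z by (simp add: diff_divide_distrib)
  also have "(\<xi> - cnj \<zeta>) * z - (\<xi> - \<zeta>) * cnj z = (\<xi> - of_real x) * (\<zeta> - cnj \<zeta>)"
    unfolding z_def by (simp add: algebra_simps)
  finally show ?thesis using d by simp
qed

text \<open>Only the puncture \<open>w = 1\<close>, which corresponds to \<open>x\<close> at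
  infinity, is missed by the parametrization.\<close>

lemma ex_real_cnj_quotient:
  fixes \<zeta> w :: complex
  assumes "Im \<zeta> > 0" "norm w = 1" "w \<noteq> 1"
  obtains x :: real where "cnj (\<zeta> - of_real x) / (\<zeta> - of_real x) = w"
proof -
  \<comment> \<open>This solves the linear equation
    \<open>cnj \<zeta> - x = w * (\<zeta> - x)\<close>. Taking \<open>Re\<close> loses nothing:
    \<open>w * cnj w = 1\<close> makes the solution equal to its own conjugate.\<close>
  define x where "x = Re ((cnj \<zeta> - w * \<zeta>) / (1 - w))"
  have w: "w * cnj w = 1"
    using assms(2) by (simp add: complex_norm_square [symmetric])
  have n: "1 - w \<noteq> 0" "1 - cnj w \<noteq> 0"
    using assms(3) by (auto simp: complex_eq_iff)
  have "cnj ((cnj \<zeta> - w * \<zeta>) / (1 - w)) = (cnj \<zeta> - w * \<zeta>) / (1 - w)"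
  proof -
    have "(\<zeta> - cnj w * cnj \<zeta>) * (1 - w) = (cnj \<zeta> - w * \<zeta>) * (1 - cnj w)"
      using w by algebra
    then show ?thesis using n by (simp add: frac_eq_eq)
  qed
  then have x: "of_real x = (cnj \<zeta> - w * \<zeta>) / (1 - w)"
    unfolding x_def by (metis Reals_cnj_iff of_real_Re)
  have "\<zeta> - of_real x \<noteq> 0" using assms(1) by (auto simp: complex_eq_iff)
  moreover have "cnj (\<zeta> - of_real x) = w * (\<zeta> - of_real x)"
  proof -
    have "of_real x * (1 - w) = cnj \<zeta> - w * \<zeta>" using x n by simp
    then show ?thesis by (simp add: algebra_simps)
  qed
  ultimately show ?thesis using that by (metis nonzero_mult_div_cancel_right)
qed

text \<open>This is the equality case of the triangle inequality: a rotation brings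
  \<open>- d\<close> into the direction of \<open>c\<close>.\<close>

lemma ex_unit_norm_diff_eq:
  fixes c d :: complex
  obtains w :: complex where "norm w = 1" "norm (c - d * w) = norm c + norm d"
proof (cases "c = 0 \<or> d = 0")
  case True
  then show ?thesis using that [of 1] by auto
next
  case False
  \<comment> \<open>Chosen so that \<open>- d * w = norm d * sgn c\<close>.\<close>
  define w where "w = - sgn c / sgn d"
  have "norm w = 1" using False by (simp add: w_def norm_divide norm_sgn)
  moreover have "c - d * w = of_real (norm c + norm d) * sgn c"
    using False by (simp add: w_def sgn_eq field_simps)
  then have "norm (c - d * w) = norm c + norm d"
    using False by (simp add: norm_mult norm_sgn del: of_real_add)
  ultimately show ?thesis using that by blast
qed

text \<open>The quotient differs from 1 by \<open>(\<xi> - \<zeta>) / (x - \<zeta>)\<close>, which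
  vanishes at infinity. The limit 1 is the value at the puncture of the circle.\<close>

lemma tendsto_diff_quotient:
  fixes \<zeta> \<xi> :: complex
  shows "((\<lambda>x::real. (\<xi> - of_real x) / (\<zeta> - of_real x)) \<longlongrightarrow> 1) at_top"
proof -
  have "filterlim (\<lambda>x::real. - \<zeta> + of_real x) at_infinity at_top"
    by (intro tendsto_add_filterlim_at_infinity [OF tendsto_const] filterlim_of_real_at_infinity)
  then have "((\<lambda>x::real. 1 - (\<xi> - \<zeta>) / (- \<zeta> + of_real x)) \<longlongrightarrow> 1 - 0) at_top"
    by (intro tendsto_diff tendsto_const tendsto_divide_0 [OF tendsto_const])
  moreover have "\<forall>\<^sub>F x::real in at_top.
      1 - (\<xi> - \<zeta>) / (- \<zeta> + of_real x) = (\<xi> - of_real x) / (\<zeta> - of_real x)"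
    using eventually_gt_at_top [of "Re \<zeta>"]
  proof eventually_elim
    case (elim x)
    then have "\<zeta> - of_real x \<noteq> 0" "- \<zeta> + of_real x \<noteq> 0" by (auto simp: complex_eq_iff)
    then show ?case by (simp add: field_simps)
  qed
  ultimately show ?thesis by (simp add: tendsto_cong)
qed

lemma SUP_norm_diff_quotient:
  fixes \<zeta> \<xi> :: complex
  assumes "Im \<zeta> > 0"
  shows "(SUP x\<in>(UNIV :: real set). norm ((\<xi> - of_real x) / (\<zeta> - of_real x)))
       = (norm (\<xi> - cnj \<zeta>) + norm (\<xi> - \<zeta>)) / (2 * Im \<zeta>)" (is "Sup (range ?f) = ?M")
proof -
  have d: "norm (\<zeta> - cnj \<zeta>) = 2 * Im \<zeta>" "\<zeta> - cnj \<zeta> \<noteq> 0"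
    using assms by (auto simp: complex_diff_cnj norm_mult)
  have f: "?f x = norm ((\<xi> - cnj \<zeta>) - (\<xi> - \<zeta>) * (cnj (\<zeta> - of_real x) / (\<zeta> - of_real x))) / (2 * Im \<zeta>)" for x
    using diff_quotient_on_circle [OF assms] by (metis d(1) norm_divide)
  have upper: "?f x \<le> ?M" for x
  proof -
    have "\<zeta> - of_real x \<noteq> 0" using assms by (auto simp: complex_eq_iff)
    then have "norm (cnj (\<zeta> - of_real x) / (\<zeta> - of_real x)) = 1"
      by (simp only: norm_divide complex_mod_cnj) simp
    then have "norm ((\<xi> - cnj \<zeta>) - (\<xi> - \<zeta>) * (cnj (\<zeta> - of_real x) / (\<zeta> - of_real x)))
        \<le> norm (\<xi> - cnj \<zeta>) + norm (\<xi> - \<zeta>)"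
      by (metis norm_triangle_ineq4 norm_mult mult.right_neutral)
    then show ?thesis unfolding f using assms by (simp add: divide_right_mono)
  qed
  \<comment> \<open>\<open>w\<close> marks a point of the full circle with largest norm.\<close>
  obtain w where w: "norm w = 1"
    "norm ((\<xi> - cnj \<zeta>) - (\<xi> - \<zeta>) * w) = norm (\<xi> - cnj \<zeta>) + norm (\<xi> - \<zeta>)"
    by (rule ex_unit_norm_diff_eq)
  have lower: "?M \<le> y" if y: "\<And>x. ?f x \<le> y" for y
  proof (cases "w = 1")
    case True \<comment> \<open>the maximum sits at the puncture of the circle, reached only as \<open>x\<close> tends to infinity\<close>
    then have "?M = 1"
      using w(2) d assms by (simp add: norm_minus_commute)
    moreover have "(?f \<longlongrightarrow> 1) at_top"
      using tendsto_norm [OF tendsto_diff_quotient] by simp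
    then have "1 \<le> y"
      by (rule tendsto_upperbound) (use y in auto)
    ultimately show ?thesis by simp
  next
    case False
    obtain x where "cnj (\<zeta> - of_real x) / (\<zeta> - of_real x) = w"
      using ex_real_cnj_quotient [OF assms w(1) False] .
    then have "?f x = ?M" using f [of x] w(2) by simp
    then show ?thesis using y [of x] by simp
  qed
  show ?thesis
    by (rule cSup_eq_non_empty) (use upper lower in auto)
qed

lemma weak_norm_eq:
  fixes \<zeta> v :: complex
  assumes "Im \<zeta> > 0"
  shows "weak_norm \<zeta> v = (norm v + Im v) / (2 * Im \<zeta>)"
proof -
  define b where "b = Im \<zeta>"
  have b: "b > 0" using assms by (simp add: b_def)
  \<comment> \<open>The closed form along the ray, with \<open>t * norm v\<close> in place of
    \<open>\<bar>t\<bar> * norm v\<close>. It agrees with the metric for \<open>t > 0\<close> and,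
    unlike the version with the absolute value, is differentiable at 0 for every
    \<open>v\<close>.\<close>
  define g where "g t = ln ((sqrt ((t * Re v)\<^sup>2 + (2 * b + t * Im v)\<^sup>2) + t * norm v) / (2 * b))" for t
  have metric: "weak_metric \<zeta> (\<zeta> + of_real t * v) = g t" if "t > 0" for t
  proof -
    have "norm (\<zeta> + of_real t * v - cnj \<zeta>) = sqrt ((t * Re v)\<^sup>2 + (2 * b + t * Im v)\<^sup>2)"
      by (simp add: cmod_def b_def)
    then show ?thesis
      using that unfolding weak_metric_def SUP_norm_diff_quotient [OF assms] g_def
      by (simp add: norm_mult b_def)
  qed
  have "g 0 = 0" using b by (simp add: g_def real_sqrt_mult)
  \<comment> \<open>At 0 the argument of \<open>ln\<close> is 1 and the square root has derivative
    \<open>Im v\<close>.\<close>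
  have "(g has_real_derivative (norm v + Im v) / (2 * b)) (at 0)"
    unfolding g_def using b
    by (auto intro!: derivative_eq_intros simp: field_simps real_sqrt_mult)
  with \<open>g 0 = 0\<close> have "((\<lambda>t. g t / t) \<longlongrightarrow> (norm v + Im v) / (2 * b)) (at 0)"
    by (simp add: has_field_derivative_iff)
  then have "((\<lambda>t. g t / t) \<longlongrightarrow> (norm v + Im v) / (2 * b)) (at_right 0)"
    by (rule tendsto_within_subset) simp
  moreover have "\<forall>\<^sub>F t in at_right 0. g t / t = weak_metric \<zeta> (\<zeta> + of_real t * v) / t"
    using metric by (auto simp: eventually_at_right_less eventually_at_filter)
  ultimately have "((\<lambda>t. weak_metric \<zeta> (\<zeta> + of_real t * v) / t) \<longlongrightarrow> (norm v + Im v) / (2 * b)) (at_right 0)"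
    by (rule Lim_transform_eventually)
  then show ?thesis unfolding weak_norm_def b_def by (intro tendsto_Lim) simp_all
qed

text \<open>The vertical projection of \<open>p\<close> is a nearest point, since
  \<open>\<bar>Im z\<bar> \<le> norm z\<close>.\<close>

lemma infdist_horizontal_line:
  "infdist p {z. Im z = h} = \<bar>Im p - h\<bar>"
proof (rule antisym)
  have "infdist p {z. Im z = h} \<le> dist p (Complex (Re p) h)"
    by (rule infdist_le) simp
  then show "infdist p {z. Im z = h} \<le> \<bar>Im p - h\<bar>"
    by (simp add: dist_norm cmod_def)
  have "Complex 0 h \<in> {z. Im z = h}" by simp
  then have ne: "{z. Im z = h} \<noteq> {}" by blast
  show "\<bar>Im p - h\<bar> \<le> infdist p {z. Im z = h}"
    unfolding infdist_notempty [OF ne]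
  proof (rule cINF_greatest [OF ne])
    fix z assume "z \<in> {z. Im z = h}"
    then show "\<bar>Im p - h\<bar> \<le> dist p z"
      using abs_Im_le_cmod [of "p - z"] by (simp add: dist_norm)
  qed
qed

theorem proposition3p2:
  fixes \<zeta> :: complex
  assumes "\<zeta> \<in> upper_half_plane"
  shows "parabola_with_focus_vertex {v. weak_norm \<zeta> v = 1} 0 (\<i> * complex_of_real (Im \<zeta>))"
proof -
  have b: "Im \<zeta> > 0" using assms by (simp add: upper_half_plane_def)
  define L where "L = {z. Im z = 2 * Im \<zeta>}"
  have L: "L = {z. \<i> \<bullet> z = 2 * Im \<zeta>}" by (simp add: L_def inner_complex_def)
  have circle: "weak_norm \<zeta> p = 1 \<longleftrightarrow> norm p + Im p = 2 * Im \<zeta>" for p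
    using b by (auto simp: weak_norm_eq field_simps)
  \<comment> \<open>Either equation forces \<open>Im p \<le> 2 * Im \<zeta>\<close>, which resolves
    the absolute value: above the directrix, \<open>norm p = Im p - 2 * Im \<zeta>\<close> would
    contradict \<open>Im p \<le> norm p\<close>.\<close>
  have "dist p 0 = infdist p L \<longleftrightarrow> norm p + Im p = 2 * Im \<zeta>" for p
    using b abs_Im_le_cmod [of p] unfolding L_def infdist_horizontal_line dist_norm diff_zero
    by linarith
  then have "{v. weak_norm \<zeta> v = 1} = {p. dist p 0 = infdist p L}"
    by (simp add: circle)
  moreover have "affine L" unfolding L by (rule affine_hyperplane)
  moreover have "aff_dim L = 1" unfolding L by (subst aff_dim_hyperplane) simp_all
  moreover have "0 \<notin> L" using b by (simp add: L_def)
  moreover have "weak_norm \<zeta> (\<i> * of_real (Im \<zeta>)) = 1"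
    using b by (simp add: circle norm_mult)
  moreover have "\<forall>x\<in>L. \<forall>y\<in>L. (\<i> * of_real (Im \<zeta>) - 0) \<bullet> (x - y) = 0"
    by (auto simp: L_def inner_complex_def)
  ultimately show ?thesis unfolding parabola_with_focus_vertex_def by blast
qed

end
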